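(* Let a point process with probability generating functional $G$ be the superposition of point processes with probability generating functionals $G_1$ and $G_2$, i.e. $G[h]=G_1[h]\,G_2[h]$. Let the Janossy densities of $G$, $G_1$, $G_2$ be $p(x_1,\ldots,x_n)$, $q(x_1,\ldots,x_n)$, $r(x_1,\ldots,x_n)$ respectively for $n>0$, with zeroth terms $p_0,q_0,r_0$, and suppose $q_0\neq 0$. Then $r_0=p_0/q_0$, and for every $n>0$, writing $\Xi=\{x_1,\ldots,x_n\}$, $$r(x_1,\ldots,x_n)=\sum_{\Pi\subseteq\Xi}\left(\sum_{\pi\in\mathrm{Part}(\Pi)}\frac{(-1)^{|\pi|}\,|\pi|!}{q_0^{|\pi|+1}}\prod_{\omega\in\pi}q\left(v_{\pi,\omega,1},\ldots,v_{\pi,\omega,|\omega|}\right)\right)p\left(w_1,\ldots,w_{|\Xi|-|\Pi|}\right),$$ where the outer sum is over all subsets $\Pi$ of $\Xi$ (including $\emptyset$ and $\Xi$), the inner sum is over all partitions $\pi$ of $\Pi$, the product is over the blocks $\omega=\{v_{\pi,\omega,1},\ldots,v_{\pi,\omega,|\omega|}\}$ of $\pi$, and $w_1,\ldots,w_{|\Xi|-|\Pi|}$ are the elements of $\Xi\setminus\Pi$.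
   Context: A point process on a state space with reference ($\sigma$-finite) measure $dx$ is described by its probability generating functional $$G[h]=p_0+\sum_{n=1}^\infty\frac{1}{n!}\int\cdots\int\left(\prod_{i=1}^n h(x_i)\right)p_n(x_1,\ldots,x_n)\,dx_1\cdots dx_n,$$ defined for measurable test functions $h$ with $|h|\le 1$, where $p_0\ge 0$, $p_n(x_1,\ldots,x_n)\ge 0$ are measurable and symmetric in their arguments, and $$p_0+\sum_{n=1}^\infty\frac{1}{n!}\int\cdots\int p_n(x_1,\ldots,x_n)\,dx_1\cdots dx_n=1.$$ The functions $p_n$ are the Janossy densities of the process (the subscript $n$ is dropped when the number of arguments is displayed) and $p_0$ is its zeroth term, $p_0=G[0]$. They are determined by $G$, densities being identified when equal almost everywhere, so equalities between densities are understood in this sense. (Formally, $p_k(x_1,\ldots,x_k)$ is the $k$-th order Gâteaux differential of $G$ at $h=0$ with increments the Dirac deltas $\delta_{x_1},\ldots,\delta_{x_k}$.) The same definitions apply to $G_1$ with $q_0$ and densities $q$, and to $G_2$ with $r_0$ and densities $r$. Conventions: $\mathrm{Part}(S)$ is the set of all partitions of a finite set $S$ into nonempty disjoint blocks, the empty set having exactly one partition, the empty one, with $|\pi|=0$ and empty product equal to $1$; $|\pi|$ is the number of blocks of $\pi$ and $|\omega|$ the number of elements of $\omega$. The points $x_1,\ldots,x_n$ are treated as labelled by their indices. When $\Pi=\Xi$, the factor $p(w_1,\ldots,w_{|\Xi|-|\Pi|})$ with no arguments means $p_0$. *)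

theory Defs
  imports "HOL-Analysis.Analysis" "HOL-Library.Multiset" "HOL-Library.Disjoint_Sets"
begin

text \<open>
  A family of densities is a single function \<open>p\<close> on lists of points: \<open>p [x\<^sub>1, \<dots>, x\<^sub>n]\<close> is the
  density \<open>p\<^sub>n(x\<^sub>1, \<dots>, x\<^sub>n)\<close> and \<open>p []\<close> is the zeroth term. The \<open>n\<close>-fold product of the
  reference measure is taken on functions with index set \<open>{..<n}\<close>, so the points
  \<open>x\<^sub>1, \<dots>, x\<^sub>n\<close> are \<open>x 0, \<dots>, x (n - 1)\<close>.
\<close>

abbreviation points_measure :: "'a measure \<Rightarrow> nat \<Rightarrow> (nat \<Rightarrow> 'a) measure" where
  "points_measure M n \<equiv> Pi\<^sub>M {..<n} (\<lambda>_. M)"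

text \<open>
  The total mass is a nonnegative extended integral: its value 1 therefore includes the
  integrability of all the densities and the convergence of the series.
\<close>

definition janossy_densities :: "'a measure \<Rightarrow> ('a list \<Rightarrow> real) \<Rightarrow> bool" where
  "janossy_densities M p \<longleftrightarrow>
     (\<forall>n>0. (\<lambda>x. p (map x [0..<n])) \<in> borel_measurable (points_measure M n)) \<and>
     (\<forall>xs. set xs \<subseteq> space M \<longrightarrow> 0 \<le> p xs) \<and>
     (\<forall>xs ys. set xs \<subseteq> space M \<longrightarrow> mset xs = mset ys \<longrightarrow> p xs = p ys) \<and>
     ennreal (p []) +
       (\<Sum>n. ennreal (1 / fact (Suc n)) *
             (\<integral>\<^sup>+x. ennreal (p (map x [0..<Suc n])) \<partial>points_measure M (Suc n))) = 1"

definition test_function :: "'a measure \<Rightarrow> ('a \<Rightarrow> real) \<Rightarrow> bool" where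
  "test_function M h \<longleftrightarrow> h \<in> borel_measurable M \<and> (\<forall>x\<in>space M. \<bar>h x\<bar> \<le> 1)"

definition pgfl :: "'a measure \<Rightarrow> ('a list \<Rightarrow> real) \<Rightarrow> ('a \<Rightarrow> real) \<Rightarrow> real" where
  "pgfl M p h =
     p [] +
     (\<Sum>n. 1 / fact (Suc n) *
           (\<integral>x. (\<Prod>i<Suc n. h (x i)) * p (map x [0..<Suc n]) \<partial>points_measure M (Suc n)))"

text \<open>
  A point process is given by its probability generating functional \<open>G\<close>; the values of \<open>G\<close>
  outside the test functions are irrelevant.
\<close>

definition point_process ::
  "'a measure \<Rightarrow> (('a \<Rightarrow> real) \<Rightarrow> real) \<Rightarrow> ('a list \<Rightarrow> real) \<Rightarrow> bool" where
  "point_process M G p \<longleftrightarrow>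
     janossy_densities M p \<and> (\<forall>h. test_function M h \<longrightarrow> G h = pgfl M p h)"

definition superposition ::
  "'a measure \<Rightarrow> (('a \<Rightarrow> real) \<Rightarrow> real) \<Rightarrow> (('a \<Rightarrow> real) \<Rightarrow> real) \<Rightarrow> (('a \<Rightarrow> real) \<Rightarrow> real) \<Rightarrow> bool" where
  "superposition M G G1 G2 \<longleftrightarrow> (\<forall>h. test_function M h \<longrightarrow> G h = G1 h * G2 h)"

text \<open>
  The density at the points labelled by a finite set \<open>S\<close> of indices. Listing \<open>S\<close> in increasing
  order is immaterial because densities are symmetric.
\<close>

definition at_labels :: "('a list \<Rightarrow> real) \<Rightarrow> (nat \<Rightarrow> 'a) \<Rightarrow> nat set \<Rightarrow> real" where
  "at_labels p x S = p (map x (sorted_list_of_set S))"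

end

theory Submission imports Defs begin

text \<open>
  Expanding the product of the two functionals and collecting terms of order \<open>n\<close>, the superposition
  ought to have the density
  \<open>s(x\<^sub>1, \<dots>, x\<^sub>n) = (\<Sum>T \<subseteq> {1..n}. q(x\<^sub>T) r(x\<^bsub>{1..n} - T\<^esub>))\<close>:
  each point belongs to exactly one of the two processes. So, regarded as functions of a finite set of
  labels, the densities satisfy \<open>p = q * r\<close>, where \<open>*\<close> is the convolution over subsets. This convolution
  is the product of exponential generating functions in disguise, and since \<open>q\<^sub>0 \<noteq> 0\<close> the function
  \<open>q\<close> has an inverse, which the geometric series of \<open>1 / (q\<^sub>0 + (q - q\<^sub>0))\<close> expresses as a sum over
  ordered partitions; forgetting the order gives the factor \<open>\<bar>\<pi>\<bar>!\<close>. The stated formula is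
  \<open>r = q\<^sup>-\<^sup>1 * p\<close> (\<open>subset_convolution_inversion\<close>).

  The analytic part is to show that \<open>p = s\<close> almost everywhere. Replacing a nonnegative test function
  \<open>h\<close> by \<open>t h\<close> turns \<open>G = G\<^sub>1 G\<^sub>2\<close> into an identity of convergent power series in \<open>t\<close>; comparing
  coefficients yields \<open>\<integral> h(x\<^sub>1) \<cdots> h(x\<^sub>n) p = \<integral> h(x\<^sub>1) \<cdots> h(x\<^sub>n) s\<close> for each \<open>n\<close>
  (\<open>weight_superposition\<close>, \<open>weight_superposed_lessThan\<close>). Polarization over sums \<open>h\<close> of indicator
  functions shows that the two symmetric densities have the same integral over every measurable box, so they agree
  almost everywhere (\<open>symmetric_AE_eqI\<close>).

  The inversion at a point \<open>x\<close> needs \<open>p = q * r\<close> at all subfamilies of the coordinates of \<open>x\<close> at once. There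
  are finitely many, and a null set of \<open>M\<^sup>k\<close> pulls back along a selection of \<open>k\<close> coordinates to a null set of
  \<open>M\<^sup>n\<close> (\<open>AE_reindex\<close>).
\<close>

section \<open>Inversion of the subset convolution\<close>

definition partition_coeff :: "('b set \<Rightarrow> real) \<Rightarrow> 'b set \<Rightarrow> real" where
  "partition_coeff f S =
     (\<Sum>\<pi> | partition_on S \<pi>.
        (- 1) ^ card \<pi> * fact (card \<pi>) / f {} ^ (card \<pi> + 1) * (\<Prod>\<omega>\<in>\<pi>. f \<omega>))"

lemma partition_coeff_empty: "partition_coeff f {} = 1 / f {}"
  by (simp add: partition_coeff_def partition_on_empty)

text \<open>
  The term \<open>T = S\<close> cancels against the others. Each other term consists of a partition of a proper
  subset \<open>T\<close> and the nonempty rest \<open>S - T\<close>, that is, of a partition of \<open>S\<close> with one distinguished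
  block. A partition with \<open>k\<close> blocks arises \<open>k\<close> times, with the coefficient that belongs to
  \<open>k - 1\<close> blocks, and \<open>k (-1)\<^bsup>k-1\<^esup> (k-1)! = - (-1)\<^sup>k k!\<close>.
\<close>
lemma partition_coeff_convolution:
  assumes S: "finite S" "S \<noteq> {}" and f0: "f {} \<noteq> 0"
  shows "(\<Sum>T\<in>Pow S. partition_coeff f T * f (S - T)) = 0"
proof -
  define c :: "nat \<Rightarrow> real" where "c k = (- 1) ^ k * fact k / f {} ^ (k + 1)" for k
  define P where "P = (\<lambda>\<pi>. \<Prod>\<omega>\<in>\<pi>. f \<omega>)"
  have pc: "partition_coeff f T = (\<Sum>\<pi> | partition_on T \<pi>. c (card \<pi>) * P \<pi>)" for T
    by (simp add: partition_coeff_def c_def P_def)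
  have c_Suc: "f {} * c (Suc k) = - (real (Suc k) * c k)" for k
    using f0 by (simp add: c_def field_simps)
  have fin: "finite \<pi>" if "partition_on T \<pi>" "T \<subseteq> S" for T \<pi>
    using that S finite_elements finite_subset by metis
  have finP: "finite {\<pi>. partition_on T \<pi>}" if "T \<subseteq> S" for T
    using that S finitely_many_partition_on finite_subset by metis
  have rem: "partition_on (S - \<omega>) (\<pi> - {\<omega>}) \<and> \<omega> \<subseteq> S \<and> \<omega> \<noteq> {} \<and> insert \<omega> (\<pi> - {\<omega>}) = \<pi>"
    if "partition_on S \<pi>" "\<omega> \<in> \<pi>" for \<pi> \<omega>
  proof -
    have i: "insert \<omega> (\<pi> - {\<omega>}) = \<pi>" using that by auto
    have "disjnt \<omega> (\<Union>(\<pi> - {\<omega>}))"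
      using partition_onD2[OF that(1)] that(2) by (auto simp: disjoint_def disjnt_def)
    from partition_on_insert[OF this, of S] that i show ?thesis by simp
  qed
  have add: "partition_on S (insert (S - T) \<pi>) \<and> S - T \<notin> \<pi>"
    if "T \<in> Pow S - {S}" "partition_on T \<pi>" for T \<pi>
  proof -
    have "disjnt (S - T) (\<Union>\<pi>)"
      using partition_onD1[OF that(2)] by (auto simp: disjnt_def)
    moreover have "S - (S - T) = T" using that(1) by auto
    ultimately have "partition_on S (insert (S - T) \<pi>)"
      using partition_on_insert[of "S - T" \<pi> S] that by auto
    moreover have "S - T \<notin> \<pi>"
      using partition_onD1[OF that(2)] that(1) by auto
    ultimately show ?thesis by simp
  qed
  have "(\<Sum>T\<in>Pow S - {S}. partition_coeff f T * f (S - T))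
      = (\<Sum>(T, \<pi>)\<in>(SIGMA T:Pow S - {S}. {\<pi>. partition_on T \<pi>}). c (card \<pi>) * P \<pi> * f (S - T))"
    using S finP by (subst sum.Sigma[symmetric]) (auto simp: pc sum_distrib_right)
  also have "\<dots> = (\<Sum>(\<pi>, \<omega>)\<in>(SIGMA \<pi>:{\<pi>. partition_on S \<pi>}. \<pi>). c (card \<pi> - 1) * P \<pi>)"
  proof (rule sum.reindex_bij_witness[where
        i = "\<lambda>(\<pi>, \<omega>). (S - \<omega>, \<pi> - {\<omega>})" and j = "\<lambda>(T, \<pi>). (insert (S - T) \<pi>, S - T)"])
    fix a assume a: "a \<in> (SIGMA T:Pow S - {S}. {\<pi>. partition_on T \<pi>})"
    obtain T \<pi> where [simp]: "a = (T, \<pi>)" by (cases a)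
    have T: "T \<in> Pow S - {S}" "partition_on T \<pi>" using a by auto
    note ad = add[OF T]
    show "(case case a of (T, \<pi>) \<Rightarrow> (insert (S - T) \<pi>, S - T) of (\<pi>, \<omega>) \<Rightarrow> (S - \<omega>, \<pi> - {\<omega>})) = a"
      using ad T by auto
    show "(case a of (T, \<pi>) \<Rightarrow> (insert (S - T) \<pi>, S - T)) \<in> (SIGMA \<pi>:{\<pi>. partition_on S \<pi>}. \<pi>)"
      using ad by auto
    have "finite \<pi>" using fin T by auto
    then show "(case case a of (T, \<pi>) \<Rightarrow> (insert (S - T) \<pi>, S - T) of (\<pi>, \<omega>) \<Rightarrow> c (card \<pi> - 1) * P \<pi>) =
         (case a of (T, \<pi>) \<Rightarrow> c (card \<pi>) * P \<pi> * f (S - T))"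
      using ad by (simp add: P_def)
  next
    fix b assume b: "b \<in> (SIGMA \<pi>:{\<pi>. partition_on S \<pi>}. \<pi>)"
    obtain \<pi> \<omega> where [simp]: "b = (\<pi>, \<omega>)" by (cases b)
    have "partition_on S \<pi>" "\<omega> \<in> \<pi>" using b by auto
    note r = rem[OF this]
    then have "S - (S - \<omega>) = \<omega>" by auto
    with r show "(case case b of (\<pi>, \<omega>) \<Rightarrow> (S - \<omega>, \<pi> - {\<omega>}) of (T, \<pi>) \<Rightarrow> (insert (S - T) \<pi>, S - T)) = b"
      by simp
    show "(case b of (\<pi>, \<omega>) \<Rightarrow> (S - \<omega>, \<pi> - {\<omega>})) \<in> (SIGMA T:Pow S - {S}. {\<pi>. partition_on T \<pi>})"
      using r by auto
  qed
  also have "\<dots> = (\<Sum>\<pi> | partition_on S \<pi>. real (card \<pi>) * c (card \<pi> - 1) * P \<pi>)"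
    using finP fin by (subst sum.Sigma[symmetric]) (auto simp: mult_ac)
  also have "\<dots> = (\<Sum>\<pi> | partition_on S \<pi>. - (f {} * c (card \<pi>) * P \<pi>))"
  proof (rule sum.cong[OF refl])
    fix \<pi> assume "\<pi> \<in> {\<pi>. partition_on S \<pi>}"
    then have "card \<pi> \<noteq> 0" using S fin partition_onD1[of S \<pi>] by fastforce
    then obtain k where "card \<pi> = Suc k" using not0_implies_Suc by auto
    with c_Suc[of k] show "real (card \<pi>) * c (card \<pi> - 1) * P \<pi> = - (f {} * c (card \<pi>) * P \<pi>)"
      by simp
  qed
  also have "\<dots> = - (partition_coeff f S * f (S - S))"
    by (simp add: pc sum_negf sum_distrib_left mult_ac)
  finally show ?thesis
    using S by (subst sum.remove[of _ S]) auto
qed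

text \<open>
  Associativity of the subset convolution, with \<open>partition_coeff f\<close> as the inverse of \<open>f\<close>.
\<close>
lemma subset_convolution_inversion:
  fixes f g h :: "'b set \<Rightarrow> real"
  assumes A: "finite A" and f0: "f {} \<noteq> 0"
    and conv: "\<And>S. S \<subseteq> A \<Longrightarrow> h S = (\<Sum>T\<in>Pow S. f T * g (S - T))"
  shows "g A = (\<Sum>S\<in>Pow A. partition_coeff f S * h (A - S))"
proof -
  have "(\<Sum>S\<in>Pow A. partition_coeff f S * h (A - S))
      = (\<Sum>(S, T)\<in>(SIGMA S:Pow A. Pow (A - S)). partition_coeff f S * f T * g (A - S - T))"
    using A by (subst sum.Sigma[symmetric]) (auto simp: conv sum_distrib_left mult_ac finite_subset)
  also have "\<dots> = (\<Sum>(R, S)\<in>(SIGMA R:Pow A. Pow R). partition_coeff f S * f (R - S) * g (A - R))"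
    by (rule sum.reindex_bij_witness[where i = "\<lambda>(R, S). (S, R - S)" and j = "\<lambda>(S, T). (S \<union> T, S)"])
      (auto intro!: arg_cong2[where f = "(*)"] arg_cong[where f = f] arg_cong[where f = g])
  also have "\<dots> = (\<Sum>R\<in>Pow A. (\<Sum>S\<in>Pow R. partition_coeff f S * f (R - S)) * g (A - R))"
    using A by (subst sum.Sigma[symmetric]) (auto simp: sum_distrib_right finite_subset)
  also have "\<dots> = (\<Sum>R\<in>Pow A. if R = {} then g A else 0)"
  proof (rule sum.cong[OF refl])
    fix R assume "R \<in> Pow A"
    then have "finite R" using A finite_subset by auto
    then show "(\<Sum>S\<in>Pow R. partition_coeff f S * f (R - S)) * g (A - R) = (if R = {} then g A else 0)"
      using f0 partition_coeff_convolution[of R f] by (auto simp: partition_coeff_empty)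
  qed
  also have "\<dots> = g A" using A by simp
  finally show ?thesis by simp
qed

section \<open>Vanishing power series\<close>

lemma power_series_zero:
  fixes a :: "nat \<Rightarrow> real"
  assumes "\<And>x. x \<noteq> 0 \<Longrightarrow> \<bar>x\<bar> < 1 \<Longrightarrow> (\<lambda>n. a n * x ^ n) sums 0"
  shows "a n = 0"
  using assms
proof (induction n arbitrary: a)
  case 0
  then show ?case
    using powser_limit_0_strong[of 1 a "\<lambda>_. 0"] by (simp add: tendsto_const_iff)
next
  case (Suc n)
  have "a 0 = 0"
    using powser_limit_0_strong[of 1 a "\<lambda>_. 0"] Suc.prems by (simp add: tendsto_const_iff)
  have "(\<lambda>n. a (Suc n) * x ^ n) sums 0" if x: "x \<noteq> 0" "\<bar>x\<bar> < 1" for x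
  proof -
    have "(\<lambda>n. a (Suc n) * x ^ Suc n) sums 0"
      using Suc.prems[OF x] \<open>a 0 = 0\<close> by (subst sums_Suc_iff) simp
    from sums_mult[OF this, of "1 / x"] x show ?thesis by (simp add: field_simps)
  qed
  then show ?case by (rule Suc.IH)
qed

section \<open>Selecting coordinates in a product of copies of a measure\<close>

definition reindex :: "'i set \<Rightarrow> ('i \<Rightarrow> 'j) \<Rightarrow> ('j \<Rightarrow> 'a) \<Rightarrow> 'i \<Rightarrow> 'a" where
  "reindex J e x = (\<lambda>j\<in>J. x (e j))"

lemma measurable_reindex:
  assumes "e ` J \<subseteq> I"
  shows "reindex J e \<in> PiM I (\<lambda>_. M) \<rightarrow>\<^sub>M PiM J (\<lambda>_. M)"
  unfolding reindex_def using assms by (intro measurable_restrict) auto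

context sigma_finite_measure
begin

sublocale product: product_sigma_finite "\<lambda>_. M"
  by unfold_locales

lemma distr_reindex:
  assumes e: "bij_betw e J I" and fin: "finite I"
  shows "distr (PiM I (\<lambda>_. M)) (PiM J (\<lambda>_. M)) (reindex J e) = PiM J (\<lambda>_. M)"
proof (rule product.PiM_eqI)
  show "finite J" using bij_betw_finite[OF e] fin by simp
  have J: "e ` J = I" "inj_on e J" using e by (auto simp: bij_betw_def)
  fix A assume A: "\<And>j. j \<in> J \<Longrightarrow> A j \<in> sets M"
  define B where "B i = A (inv_into J e i)" for i
  have B: "B (e j) = A j" if "j \<in> J" for j using that J by (simp add: B_def)
  have "reindex J e -` Pi\<^sub>E J A \<inter> space (PiM I (\<lambda>_. M)) = Pi\<^sub>E I B"
  proof (intro set_eqI iffI)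
    fix x assume "x \<in> reindex J e -` Pi\<^sub>E J A \<inter> space (PiM I (\<lambda>_. M))"
    then show "x \<in> Pi\<^sub>E I B"
      using J(1) B by (auto simp: reindex_def space_PiM PiE_iff)
  next
    fix x assume x: "x \<in> Pi\<^sub>E I B"
    then have "x (e j) \<in> A j" if "j \<in> J" for j using that J B by (auto simp: PiE_iff)
    moreover from this have "x i \<in> space M" if "i \<in> I" for i
      using that A[THEN sets.sets_into_space] J by blast
    ultimately show "x \<in> reindex J e -` Pi\<^sub>E J A \<inter> space (PiM I (\<lambda>_. M))"
      using x by (auto simp: reindex_def space_PiM PiE_iff)
  qed
  moreover have BM: "B i \<in> sets M" if "i \<in> I" for i using that A B J by auto
  ultimately have "distr (PiM I (\<lambda>_. M)) (PiM J (\<lambda>_. M)) (reindex J e) (Pi\<^sub>E J A) = (\<Prod>i\<in>I. emeasure M (B i))"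
    using A J \<open>finite J\<close> fin measurable_reindex[of e J I M]
    by (subst emeasure_distr) (auto simp: product.emeasure_PiM intro!: sets_PiM_I_finite)
  also have "\<dots> = (\<Prod>j\<in>J. emeasure M (A j))"
    using prod.reindex[OF J(2), of "\<lambda>i. emeasure M (B i)"] B J(1) by simp
  finally show "distr (PiM I (\<lambda>_. M)) (PiM J (\<lambda>_. M)) (reindex J e) (Pi\<^sub>E J A) = (\<Prod>j\<in>J. emeasure M (A j))" .
qed simp

lemma nn_integral_reindex:
  assumes "bij_betw e J I" "finite I" "F \<in> borel_measurable (PiM J (\<lambda>_. M))"
  shows "(\<integral>\<^sup>+x. F (reindex J e x) \<partial>PiM I (\<lambda>_. M)) = (\<integral>\<^sup>+y. F y \<partial>PiM J (\<lambda>_. M))"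
proof -
  have "reindex J e \<in> PiM I (\<lambda>_. M) \<rightarrow>\<^sub>M PiM J (\<lambda>_. M)"
    using assms(1) by (intro measurable_reindex) (auto simp: bij_betw_def)
  then have "integral\<^sup>N (distr (PiM I (\<lambda>_. M)) (PiM J (\<lambda>_. M)) (reindex J e)) F
      = (\<integral>\<^sup>+x. F (reindex J e x) \<partial>PiM I (\<lambda>_. M))"
    using assms(3) by (intro nn_integral_distr) auto
  then show ?thesis by (simp add: distr_reindex[OF assms(1,2)])
qed

text \<open>
  The preimage of a null set \<open>N\<close> is a cylinder over the coordinates \<open>e ` J\<close>. By Tonelli its measure is the
  product of \<open>0\<close> and the measure of the remaining factor, which vanishes even if that factor
  has infinite measure.
\<close>
lemma AE_reindex:
  fixes e :: "'i \<Rightarrow> 'j"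
  assumes e: "inj_on e J" "e ` J \<subseteq> I" and fin: "finite I"
    and P: "AE y in PiM J (\<lambda>_. M). P y"
  shows "AE x in PiM I (\<lambda>_. M). P (reindex J e x)"
proof -
  define K where "K = e ` J"
  have K: "K \<subseteq> I" "finite K" "finite (I - K)" "K \<union> (I - K) = I" "K \<inter> (I - K) = {}"
    using e fin finite_subset by (auto simp: K_def)
  have bij: "bij_betw e J K" using e by (auto simp: K_def bij_betw_def)
  note [measurable] = measurable_reindex[of e J K M] measurable_reindex[OF e(2), of M]
  obtain N where N: "N \<in> null_sets (PiM J (\<lambda>_. M))" and sub: "{y \<in> space (PiM J (\<lambda>_. M)). \<not> P y} \<subseteq> N"
    using P by (auto simp: eventually_ae_filter)
  have [measurable]: "N \<in> sets (PiM J (\<lambda>_. M))" using N by auto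
  have mN: "(indicator N :: _ \<Rightarrow> ennreal) \<in> borel_measurable (PiM J (\<lambda>_. M))" by simp
  have "(\<integral>\<^sup>+x. indicator N (reindex J e x) \<partial>PiM I (\<lambda>_. M))
     = (\<integral>\<^sup>+x. indicator N (reindex J e x) \<partial>PiM (K \<union> (I - K)) (\<lambda>_. M))" using K by simp
  also have "\<dots> = (\<integral>\<^sup>+x. \<integral>\<^sup>+y. indicator N (reindex J e (merge K (I - K) (x, y))) \<partial>PiM (I - K) (\<lambda>_. M) \<partial>PiM K (\<lambda>_. M))"
    by (rule product.product_nn_integral_fold) (use K in \<open>auto intro!: measurable_compose[OF measurable_reindex[OF e(2)]] mN\<close>)
  also have "\<dots> = (\<integral>\<^sup>+x. indicator N (reindex J e x) * emeasure (PiM (I - K) (\<lambda>_. M)) (space (PiM (I - K) (\<lambda>_. M))) \<partial>PiM K (\<lambda>_. M))"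
  proof (rule nn_integral_cong)
    fix x :: "'j \<Rightarrow> 'a"
    have "reindex J e (merge K (I - K) (x, y)) = reindex J e x" for y
      by (auto simp: reindex_def K_def merge_def fun_eq_iff)
    then show "(\<integral>\<^sup>+y. indicator N (reindex J e (merge K (I - K) (x, y))) \<partial>PiM (I - K) (\<lambda>_. M))
        = indicator N (reindex J e x) * emeasure (PiM (I - K) (\<lambda>_. M)) (space (PiM (I - K) (\<lambda>_. M)))"
      by simp
  qed
  also have "\<dots> = (\<integral>\<^sup>+x. indicator N (reindex J e x) \<partial>PiM K (\<lambda>_. M)) * emeasure (PiM (I - K) (\<lambda>_. M)) (space (PiM (I - K) (\<lambda>_. M)))"
    by (intro nn_integral_multc measurable_compose[OF measurable_reindex mN]) (simp add: K_def)
  also have "(\<integral>\<^sup>+x. indicator N (reindex J e x) \<partial>PiM K (\<lambda>_. M)) = 0"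
    using nn_integral_reindex[OF bij K(2) mN] N by auto
  finally have "(\<integral>\<^sup>+x. indicator N (reindex J e x) \<partial>PiM I (\<lambda>_. M)) = 0" by simp
  then have "AE x in PiM I (\<lambda>_. M). indicator N (reindex J e x) = (0::ennreal)"
    by (subst (asm) nn_integral_0_iff_AE) (auto intro!: measurable_compose[OF measurable_reindex[OF e(2)] mN])
  with AE_space show ?thesis
  proof eventually_elim
    case (elim x)
    have "reindex J e x \<in> space (PiM J (\<lambda>_. M))"
      using measurable_space[OF measurable_reindex[OF e(2)] elim(1)] .
    with elim(2) sub show ?case by (auto simp: indicator_def split: if_splits)
  qed
qed

end

section \<open>Symmetric densities are determined by the integrals of products\<close>

lemma subset_sums_zero:
  fixes g :: "'b set \<Rightarrow> real"
  assumes "finite A" and "\<And>K. K \<subseteq> A \<Longrightarrow> (\<Sum>J\<in>Pow K. g J) = 0"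
  shows "g A = 0"
  using assms
proof (induction A rule: finite_psubset_induct)
  case (psubset A)
  have "g J = 0" if "J \<subset> A" for J
    using that by (intro psubset.IH psubset.prems) auto
  then have "(\<Sum>J\<in>Pow A - {A}. g J) = 0"
    by (intro sum.neutral) auto
  moreover have "(\<Sum>J\<in>Pow A. g J) = 0" by (rule psubset.prems) simp
  ultimately show ?case
    using psubset.hyps by (subst (asm) sum.remove[of _ A]) auto
qed

text \<open>
  The maps \<open>I \<rightarrow> K\<close> are sorted by their image. Sums over all maps into \<open>K\<close> determine, by inclusion
  and exclusion over \<open>K\<close>, the sum over the maps with image exactly \<open>I\<close>, and these are the permutations of
  \<open>I\<close>.
\<close>
lemma polarization:
  fixes D :: "('i \<Rightarrow> 'i) \<Rightarrow> real"
  assumes I: "finite I"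
    and zero: "\<And>K. K \<subseteq> I \<Longrightarrow> (\<Sum>\<phi>\<in>I \<rightarrow>\<^sub>E K. D \<phi>) = 0"
    and sym: "\<And>\<phi>. bij_betw \<phi> I I \<Longrightarrow> D \<phi> = d"
  shows "d = 0"
proof -
  define F where "F = (\<lambda>K. {\<phi> \<in> I \<rightarrow>\<^sub>E I. \<phi> ` I = K})"
  have finF: "finite (F K)" for K using finite_PiE[OF I I] by (simp add: F_def)
  have "(\<Sum>\<phi>\<in>F I. D \<phi>) = 0"
  proof (rule subset_sums_zero[OF I])
    fix K assume K: "K \<subseteq> I"
    then have [simp]: "finite K" using I finite_subset by auto
    have U: "I \<rightarrow>\<^sub>E K = (\<Union>J\<in>Pow K. F J)"
    proof (intro equalityI subsetI)
      fix \<phi> assume "\<phi> \<in> I \<rightarrow>\<^sub>E K"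
      then have "\<phi> ` I \<subseteq> K" "\<phi> \<in> I \<rightarrow>\<^sub>E I" using K by (auto simp: PiE_iff)
      then show "\<phi> \<in> (\<Union>J\<in>Pow K. F J)" by (simp add: F_def)
    next
      fix \<phi> assume "\<phi> \<in> (\<Union>J\<in>Pow K. F J)"
      then have "\<phi> \<in> extensional I" "\<phi> ` I \<subseteq> K" by (auto simp: F_def PiE_iff)
      then show "\<phi> \<in> I \<rightarrow>\<^sub>E K" unfolding PiE_iff by blast
    qed
    have "(\<Sum>\<phi>\<in>I \<rightarrow>\<^sub>E K. D \<phi>) = (\<Sum>J\<in>Pow K. \<Sum>\<phi>\<in>F J. D \<phi>)"
      unfolding U by (rule sum.UNION_disjoint) (auto simp: finF, auto simp: F_def)
    with zero[OF K] show "(\<Sum>J\<in>Pow K. \<Sum>\<phi>\<in>F J. D \<phi>) = 0" by simp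
  qed
  moreover have "D \<phi> = d" if "\<phi> \<in> F I" for \<phi>
    using that I by (intro sym) (auto simp: F_def bij_betw_def intro!: eq_card_imp_inj_on)
  ultimately have "real (card (F I)) * d = 0" by simp
  moreover have "restrict id I \<in> F I" by (auto simp: F_def)
  then have "card (F I) \<noteq> 0" using finF by auto
  ultimately show "d = 0" by simp
qed

lemma nn_integral_prod_sum_indicator:
  assumes I: "finite I" "finite K" and \<mu>: "sets \<mu> = sets (PiM I (\<lambda>_. M))"
    and A: "\<And>i. i \<in> K \<Longrightarrow> A i \<in> sets M"
  shows "(\<integral>\<^sup>+x. (\<Prod>j\<in>I. \<Sum>i\<in>K. indicator (A i) (x j)) \<partial>\<mu>)
    = (\<Sum>\<phi>\<in>I \<rightarrow>\<^sub>E K. emeasure \<mu> (Pi\<^sub>E I (A \<circ> \<phi>)))"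
proof -
  have AM: "Pi\<^sub>E I (A \<circ> \<phi>) \<in> sets \<mu>" if "\<phi> \<in> I \<rightarrow>\<^sub>E K" for \<phi>
    using that A I unfolding \<mu> by (intro sets_PiM_I_finite) (auto simp: PiE_iff)
  have "(\<integral>\<^sup>+x. (\<Prod>j\<in>I. \<Sum>i\<in>K. indicator (A i) (x j)) \<partial>\<mu>)
    = (\<integral>\<^sup>+x. (\<Sum>\<phi>\<in>I \<rightarrow>\<^sub>E K. indicator (Pi\<^sub>E I (A \<circ> \<phi>)) x) \<partial>\<mu>)"
  proof (rule nn_integral_cong)
    fix x assume "x \<in> space \<mu>"
    then have x: "x \<in> extensional I"
      using sets_eq_imp_space_eq[OF \<mu>] by (auto simp: space_PiM PiE_iff)
    have "(\<Prod>j\<in>I. indicator (A (\<phi> j)) (x j)) = (indicator (Pi\<^sub>E I (A \<circ> \<phi>)) x :: ennreal)" for \<phi>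
    proof (cases "x \<in> Pi\<^sub>E I (A \<circ> \<phi>)")
      case True
      then show ?thesis by (auto simp: PiE_iff intro!: prod.neutral)
    next
      case False
      then obtain j where "j \<in> I" "x j \<notin> A (\<phi> j)" using x by (auto simp: PiE_iff)
      with False show ?thesis using I by (auto simp: prod_zero_iff indicator_def)
    qed
    then show "(\<Prod>j\<in>I. \<Sum>i\<in>K. indicator (A i) (x j)) = (\<Sum>\<phi>\<in>I \<rightarrow>\<^sub>E K. indicator (Pi\<^sub>E I (A \<circ> \<phi>)) x :: ennreal)"
      using I by (simp add: prod_sum_PiE)
  qed
  also have "\<dots> = (\<Sum>\<phi>\<in>I \<rightarrow>\<^sub>E K. emeasure \<mu> (Pi\<^sub>E I (A \<circ> \<phi>)))"
    using AM by (subst nn_integral_sum) auto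
  finally show ?thesis .
qed

text \<open>
  A box with sides \<open>A i\<close> is reached from the functions \<open>h = (\<Sum>i\<in>K. indicator (A i)) / N\<close>, where \<open>K\<close> is a
  set of indices: expanding the product of the \<open>h (x i)\<close> gives the sum of the measures of all boxes with
  sides \<open>A (\<phi> i)\<close>, \<open>\<phi>\<close> a map into \<open>K\<close>. Polarization isolates the permutations \<open>\<phi>\<close>, and for these the
  boxes have equal measure by symmetry.
\<close>
lemma symmetric_measure_eqI:
  assumes I: "finite I"
    and \<mu>: "finite_measure \<mu>" "sets \<mu> = sets (PiM I (\<lambda>_. M))"
    and \<nu>: "finite_measure \<nu>" "sets \<nu> = sets (PiM I (\<lambda>_. M))"
    and sym: "\<And>e A. bij_betw e I I \<Longrightarrow> (\<And>i. i \<in> I \<Longrightarrow> A i \<in> sets M) \<Longrightarrow>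
        emeasure \<mu> (Pi\<^sub>E I (A \<circ> e)) = emeasure \<mu> (Pi\<^sub>E I A) \<and>
        emeasure \<nu> (Pi\<^sub>E I (A \<circ> e)) = emeasure \<nu> (Pi\<^sub>E I A)"
    and eq: "\<And>h. h \<in> borel_measurable M \<Longrightarrow> (\<And>x. 0 \<le> h x \<and> h x \<le> (1::real)) \<Longrightarrow>
        (\<integral>\<^sup>+x. (\<Prod>i\<in>I. ennreal (h (x i))) \<partial>\<mu>) = (\<integral>\<^sup>+x. (\<Prod>i\<in>I. ennreal (h (x i))) \<partial>\<nu>)"
  shows "\<mu> = \<nu>"
proof -
  interpret \<mu>: finite_measure \<mu> by fact
  interpret \<nu>: finite_measure \<nu> by fact
  show ?thesis
  proof (rule measure_eqI_PiM_finite[OF I \<mu>(2) \<nu>(2)])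
    fix A :: "'a \<Rightarrow> 'b set" assume A: "\<And>i. i \<in> I \<Longrightarrow> A i \<in> sets M"
    define D where "D = (\<lambda>\<phi>. measure \<mu> (Pi\<^sub>E I (A \<circ> \<phi>)) - measure \<nu> (Pi\<^sub>E I (A \<circ> \<phi>)))"
    have "measure \<mu> (Pi\<^sub>E I A) - measure \<nu> (Pi\<^sub>E I A) = 0"
    proof (rule polarization[OF I, where D = D])
      show "D \<phi> = measure \<mu> (Pi\<^sub>E I A) - measure \<nu> (Pi\<^sub>E I A)" if "bij_betw \<phi> I I" for \<phi>
        using sym[OF that A] by (simp add: D_def measure_def)
    next
      fix K assume K: "K \<subseteq> I"
      then have finK: "finite K" using I finite_subset by auto
      \<comment> \<open>The divisor keeps \<open>h\<close> below 1 where the sets overlap; the summand 1 keeps it positive for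
          empty \<open>I\<close>.\<close>
      define N where "N = real (card I + 1)"
      have N: "N > 0" by (simp add: N_def)
      define h where "h = (\<lambda>x. (\<Sum>i\<in>K. indicator (A i) x) / N)"
      have [measurable]: "A i \<in> sets M" if "i \<in> K" for i using that K A by auto
      have hM: "h \<in> borel_measurable M" unfolding h_def by measurable
      have h0: "0 \<le> h x" for x using N by (auto simp: h_def intro!: divide_nonneg_pos sum_nonneg)
      have h1: "h x \<le> 1" for x
      proof -
        have "(\<Sum>i\<in>K. indicator (A i) x :: real) \<le> (\<Sum>i\<in>K. 1)"
          by (intro sum_mono) (auto simp: indicator_def)
        also have "\<dots> \<le> N" using card_mono[OF I K] by (simp add: N_def)
        finally show ?thesis using N by (simp add: h_def)
      qed
      have hN: "ennreal N * ennreal (h x) = (\<Sum>i\<in>K. indicator (A i) x)" for x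
        using N h0 by (simp add: ennreal_mult[symmetric] h_def ennreal_indicator[symmetric])
      have scale: "(\<Sum>\<phi>\<in>I \<rightarrow>\<^sub>E K. emeasure \<xi> (Pi\<^sub>E I (A \<circ> \<phi>)))
          = ennreal N ^ card I * (\<integral>\<^sup>+x. (\<Prod>i\<in>I. ennreal (h (x i))) \<partial>\<xi>)"
        if \<xi>: "sets \<xi> = sets (PiM I (\<lambda>_. M))" for \<xi>
      proof -
        have "(\<Sum>\<phi>\<in>I \<rightarrow>\<^sub>E K. emeasure \<xi> (Pi\<^sub>E I (A \<circ> \<phi>)))
          = (\<integral>\<^sup>+x. (\<Prod>j\<in>I. \<Sum>i\<in>K. indicator (A i) (x j)) \<partial>\<xi>)"
          using K A by (intro nn_integral_prod_sum_indicator[OF I finK \<xi>, symmetric]) auto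
        also have "\<dots> = (\<integral>\<^sup>+x. ennreal N ^ card I * (\<Prod>i\<in>I. ennreal (h (x i))) \<partial>\<xi>)"
          by (simp add: hN[symmetric] prod.distrib)
        also have "\<dots> = ennreal N ^ card I * (\<integral>\<^sup>+x. (\<Prod>i\<in>I. ennreal (h (x i))) \<partial>\<xi>)"
        proof (rule nn_integral_cmult)
          have "(\<lambda>x. h (x i)) \<in> borel_measurable (PiM I (\<lambda>_. M))" if "i \<in> I" for i
            using measurable_compose[OF measurable_component_singleton[OF that] hM] .
          then show "(\<lambda>x. \<Prod>i\<in>I. ennreal (h (x i))) \<in> borel_measurable \<xi>"
            unfolding measurable_cong_sets[OF \<xi> refl]
            by (intro borel_measurable_prod_ennreal measurable_compose[OF _ measurable_ennreal])
        qed
        finally show ?thesis .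
      qed
      have "(\<Sum>\<phi>\<in>I \<rightarrow>\<^sub>E K. emeasure \<mu> (Pi\<^sub>E I (A \<circ> \<phi>))) = (\<Sum>\<phi>\<in>I \<rightarrow>\<^sub>E K. emeasure \<nu> (Pi\<^sub>E I (A \<circ> \<phi>)))"
        using eq[OF hM] h0 h1 by (simp add: scale \<mu> \<nu>)
      then have "(\<Sum>\<phi>\<in>I \<rightarrow>\<^sub>E K. measure \<mu> (Pi\<^sub>E I (A \<circ> \<phi>))) = (\<Sum>\<phi>\<in>I \<rightarrow>\<^sub>E K. measure \<nu> (Pi\<^sub>E I (A \<circ> \<phi>)))"
        by (simp add: \<mu>.emeasure_eq_measure \<nu>.emeasure_eq_measure sum_nonneg)
      then show "(\<Sum>\<phi>\<in>I \<rightarrow>\<^sub>E K. D \<phi>) = 0" by (simp add: D_def sum_subtractf)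
    qed
    then show "emeasure \<mu> (Pi\<^sub>E I A) = emeasure \<nu> (Pi\<^sub>E I A)"
      by (simp add: \<mu>.emeasure_eq_measure \<nu>.emeasure_eq_measure)
  next
    show "range (\<lambda>_::nat. space (PiM I (\<lambda>_. M))) \<subseteq> prod_algebra I (\<lambda>_. M)"
      using I by (auto simp: space_PiM intro!: prod_algebraI_finite)
  qed auto
qed

context sigma_finite_measure
begin

text \<open>
  Densities with respect to a \<open>\<sigma>\<close>-finite measure are compared through the finite measures they define;
  the permutation invariance of these measures is inherited from the product measure and the
  densities.
\<close>
lemma symmetric_AE_eqI:
  fixes f g :: "('i \<Rightarrow> 'a) \<Rightarrow> real"
  assumes I: "finite I"
    and fM: "f \<in> borel_measurable (PiM I (\<lambda>_. M))" and gM: "g \<in> borel_measurable (PiM I (\<lambda>_. M))"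
    and f0: "\<And>x. x \<in> space (PiM I (\<lambda>_. M)) \<Longrightarrow> 0 \<le> f x"
    and g0: "\<And>x. x \<in> space (PiM I (\<lambda>_. M)) \<Longrightarrow> 0 \<le> g x"
    and fsym: "\<And>e x. bij_betw e I I \<Longrightarrow> x \<in> space (PiM I (\<lambda>_. M)) \<Longrightarrow> f (reindex I e x) = f x"
    and gsym: "\<And>e x. bij_betw e I I \<Longrightarrow> x \<in> space (PiM I (\<lambda>_. M)) \<Longrightarrow> g (reindex I e x) = g x"
    and fin: "(\<integral>\<^sup>+x. ennreal (f x) \<partial>PiM I (\<lambda>_. M)) < \<infinity>"
    and eq: "\<And>h. h \<in> borel_measurable M \<Longrightarrow> (\<And>x. 0 \<le> h x \<and> h x \<le> (1::real)) \<Longrightarrow>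
        (\<integral>\<^sup>+x. ennreal ((\<Prod>i\<in>I. h (x i)) * f x) \<partial>PiM I (\<lambda>_. M))
      = (\<integral>\<^sup>+x. ennreal ((\<Prod>i\<in>I. h (x i)) * g x) \<partial>PiM I (\<lambda>_. M))"
  shows "AE x in PiM I (\<lambda>_. M). f x = g x"
proof -
  let ?P = "PiM I (\<lambda>_. M)"
  note [measurable] = fM gM
  have fing: "(\<integral>\<^sup>+x. ennreal (g x) \<partial>?P) < \<infinity>"
    using eq[of "\<lambda>_. 1"] fin by simp
  have sym: "emeasure (density ?P (\<lambda>x. ennreal (k x))) (Pi\<^sub>E I (A \<circ> e)) = emeasure (density ?P (\<lambda>x. ennreal (k x))) (Pi\<^sub>E I A)"
    if e: "bij_betw e I I" and A: "\<And>i. i \<in> I \<Longrightarrow> A i \<in> sets M" and kM[measurable]: "k \<in> borel_measurable ?P"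
      and ksym: "\<And>x. x \<in> space ?P \<Longrightarrow> k (reindex I e x) = k x" for k e A
  proof -
    have eI: "e ` I = I" using e by (simp add: bij_betw_def)
    have "e i \<in> I" if "i \<in> I" for i using that eI by auto
    then have [measurable]: "Pi\<^sub>E I A \<in> sets ?P" "Pi\<^sub>E I (A \<circ> e) \<in> sets ?P"
      using A I by (auto intro!: sets_PiM_I_finite)
    have "(\<integral>\<^sup>+y. ennreal (k y) * indicator (Pi\<^sub>E I (A \<circ> e)) y \<partial>?P)
        = (\<integral>\<^sup>+x. ennreal (k (reindex I e x)) * indicator (Pi\<^sub>E I (A \<circ> e)) (reindex I e x) \<partial>?P)"
      by (rule nn_integral_reindex[OF e I, symmetric]) measurable
    also have "\<dots> = (\<integral>\<^sup>+x. ennreal (k x) * indicator (Pi\<^sub>E I A) x \<partial>?P)"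
    proof (rule nn_integral_cong)
      fix x assume x: "x \<in> space ?P"
      have "reindex I e x \<in> Pi\<^sub>E I (A \<circ> e) \<longleftrightarrow> (\<forall>i\<in>e ` I. x i \<in> A i)"
        by (auto simp: reindex_def PiE_iff)
      also have "\<dots> \<longleftrightarrow> x \<in> Pi\<^sub>E I A" using x eI by (auto simp: space_PiM PiE_iff)
      finally show "ennreal (k (reindex I e x)) * indicator (Pi\<^sub>E I (A \<circ> e)) (reindex I e x)
          = ennreal (k x) * indicator (Pi\<^sub>E I A) x"
        using ksym[OF x] by (simp add: indicator_def)
    qed
    finally show ?thesis by (simp add: emeasure_density)
  qed
  have h_int: "(\<integral>\<^sup>+x. (\<Prod>i\<in>I. ennreal (h (x i))) \<partial>density ?P (\<lambda>x. ennreal (k x)))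
      = (\<integral>\<^sup>+x. ennreal ((\<Prod>i\<in>I. h (x i)) * k x) \<partial>?P)"
    if hM: "h \<in> borel_measurable M" and h0: "\<And>x. 0 \<le> h x \<and> h x \<le> (1::real)"
      and [measurable]: "k \<in> borel_measurable ?P" and k0: "\<And>x. x \<in> space ?P \<Longrightarrow> 0 \<le> k x" for h k
  proof -
    have "(\<lambda>x. h (x i)) \<in> borel_measurable ?P" if "i \<in> I" for i
      using measurable_compose[OF measurable_component_singleton[OF that] hM] .
    then have "(\<lambda>x. \<Prod>i\<in>I. ennreal (h (x i))) \<in> borel_measurable ?P"
      by (intro borel_measurable_prod_ennreal measurable_compose[OF _ measurable_ennreal])
    then have "(\<integral>\<^sup>+x. (\<Prod>i\<in>I. ennreal (h (x i))) \<partial>density ?P (\<lambda>x. ennreal (k x)))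
      = (\<integral>\<^sup>+x. ennreal (k x) * (\<Prod>i\<in>I. ennreal (h (x i))) \<partial>?P)"
      by (intro nn_integral_density) auto
    also have "\<dots> = (\<integral>\<^sup>+x. ennreal ((\<Prod>i\<in>I. h (x i)) * k x) \<partial>?P)"
      using h0 k0 by (intro nn_integral_cong)
        (simp add: prod_ennreal ennreal_mult prod_nonneg mult.commute)
    finally show ?thesis .
  qed
  have "density ?P (\<lambda>x. ennreal (f x)) = density ?P (\<lambda>x. ennreal (g x))"
  proof (rule symmetric_measure_eqI[OF I])
    show "finite_measure (density ?P (\<lambda>x. ennreal (f x)))" "finite_measure (density ?P (\<lambda>x. ennreal (g x)))"
      using fin fing by (auto intro!: finite_measureI simp: emeasure_density less_top)
  qed (use sym[OF _ _ fM fsym] sym[OF _ _ gM gsym] h_int[OF _ _ fM f0] h_int[OF _ _ gM g0] eq in auto)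
  then have "AE x in ?P. ennreal (f x) = ennreal (g x)"
    using fin by (subst (asm) finite_density_unique) auto
  with AE_space show ?thesis
    by eventually_elim (use f0 g0 in auto)
qed

end

section \<open>Densities at labelled points\<close>

lemma at_labels_empty [simp]: "at_labels p x {} = p []"
  by (simp add: at_labels_def)

lemma at_labels_lessThan: "at_labels p x {..<n} = p (map x [0..<n])"
  by (simp add: at_labels_def lessThan_atLeast0)

lemma at_labels_enumerate:
  assumes "finite S"
  shows "at_labels p x S
    = at_labels p (reindex {..<card S} ((!) (sorted_list_of_set S)) x) {..<card S}"
proof -
  have "map (reindex {..<card S} ((!) (sorted_list_of_set S)) x) [0..<card S] = map x (sorted_list_of_set S)"
    by (rule nth_equalityI) (auto simp: reindex_def)
  then show ?thesis unfolding at_labels_lessThan by (simp add: at_labels_def)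
qed

lemma bij_betw_enumerate:
  "finite (S :: nat set) \<Longrightarrow> bij_betw ((!) (sorted_list_of_set S)) {..<card S} S"
  by (rule bij_betw_nth) auto

lemma janossy_densities_nonneg:
  "janossy_densities M p \<Longrightarrow> set xs \<subseteq> space M \<Longrightarrow> 0 \<le> p xs"
  unfolding janossy_densities_def by blast

lemma at_labels_nonneg:
  assumes p: "janossy_densities M p" and "finite S" "\<And>i. i \<in> S \<Longrightarrow> x i \<in> space M"
  shows "0 \<le> at_labels p x S"
proof -
  have "set (map x (sorted_list_of_set S)) \<subseteq> space M" using assms by auto
  then show ?thesis unfolding at_labels_def by (rule janossy_densities_nonneg[OF p])
qed

lemma mset_sorted_list_of_set: "mset (sorted_list_of_set A) = mset_set A"
  by (metis mset_sorted_list_of_multiset sorted_list_of_mset_set)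

text \<open>
  The map \<open>e\<close> may change the order of the labels, so this rests on the symmetry of the densities.
\<close>
lemma at_labels_reindex:
  assumes p: "janossy_densities M p" and S: "finite S" "S \<subseteq> J" and e: "inj_on e S"
    and x: "\<And>i. i \<in> S \<Longrightarrow> x (e i) \<in> space M"
  shows "at_labels p (reindex J e x) S = at_labels p x (e ` S)"
proof -
  have fin: "finite (e ` S)" using S by simp
  have "mset (map (reindex J e x) (sorted_list_of_set S)) = image_mset (\<lambda>i. x (e i)) (mset_set S)"
    using S by (auto simp: mset_sorted_list_of_set reindex_def intro!: image_mset_cong)
  also have "\<dots> = mset (map x (sorted_list_of_set (e ` S)))"
    by (simp add: mset_sorted_list_of_set image_mset_mset_set[OF e, symmetric] multiset.map_comp comp_def)
  finally have "mset (map x (sorted_list_of_set (e ` S))) = mset (map (reindex J e x) (sorted_list_of_set S))"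
    by simp
  moreover have "set (map x (sorted_list_of_set (e ` S))) \<subseteq> space M" using x fin by auto
  ultimately show ?thesis
    using p unfolding janossy_densities_def at_labels_def by metis
qed

lemma measurable_at_labels:
  assumes p: "janossy_densities M p" and S: "finite S" "S \<subseteq> I"
  shows "(\<lambda>x. at_labels p x S) \<in> borel_measurable (PiM I (\<lambda>_. M))"
proof (cases "S = {}")
  case False
  let ?e = "(!) (sorted_list_of_set S)"
  have "card S > 0" using S False by (simp add: card_gt_0_iff)
  then have "(\<lambda>x. at_labels p x {..<card S}) \<in> borel_measurable (points_measure M (card S))"
    using p by (simp add: janossy_densities_def at_labels_lessThan)
  moreover have "?e ` {..<card S} \<subseteq> I"
    using bij_betw_enumerate[OF S(1)] S(2) by (simp add: bij_betw_def)
  ultimately show ?thesis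
    by (subst at_labels_enumerate[OF S(1)])
      (rule measurable_compose[OF measurable_reindex])
qed simp

text \<open>
  The density at the labels \<open>S\<close> of the superposition of independent processes with densities \<open>q\<close> and
  \<open>r\<close>: the labels in \<open>T\<close> come from the first process and the others from the second.
\<close>
definition superposed :: "('a list \<Rightarrow> real) \<Rightarrow> ('a list \<Rightarrow> real) \<Rightarrow> (nat \<Rightarrow> 'a) \<Rightarrow> nat set \<Rightarrow> real" where
  "superposed q r x S = (\<Sum>T\<in>Pow S. at_labels q x T * at_labels r x (S - T))"

lemma superposed_reindex:
  assumes q: "janossy_densities M q" and r: "janossy_densities M r"
    and S: "finite S" "S \<subseteq> J" and e: "inj_on e S"
    and x: "\<And>i. i \<in> S \<Longrightarrow> x (e i) \<in> space M"
  shows "superposed q r (reindex J e x) S = superposed q r x (e ` S)"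
proof -
  have sub: "at_labels s (reindex J e x) T = at_labels s x (e ` T)"
    if "janossy_densities M s" "T \<subseteq> S" for s T
    using that S e x finite_subset inj_on_subset by (intro at_labels_reindex) blast+
  have "superposed q r (reindex J e x) S
      = (\<Sum>T\<in>Pow S. at_labels q x (e ` T) * at_labels r x (e ` S - e ` T))"
    unfolding superposed_def
    using e by (intro sum.cong) (auto simp: sub q r inj_on_image_set_diff)
  also have "\<dots> = superposed q r x (e ` S)"
    unfolding superposed_def image_Pow_surj[OF refl, symmetric]
    using inj_on_image_Pow[OF e] by (simp add: sum.reindex)
  finally show ?thesis .
qed

lemma superposed_nonneg:
  assumes "janossy_densities M q" "janossy_densities M r" "finite S" "\<And>i. i \<in> S \<Longrightarrow> x i \<in> space M"
  shows "0 \<le> superposed q r x S"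
  unfolding superposed_def using assms finite_subset
  by (intro sum_nonneg mult_nonneg_nonneg at_labels_nonneg) auto

lemma measurable_superposed:
  assumes "janossy_densities M q" "janossy_densities M r" "finite S" "S \<subseteq> I"
  shows "(\<lambda>x. superposed q r x S) \<in> borel_measurable (PiM I (\<lambda>_. M))"
  unfolding superposed_def using assms finite_subset
  by (intro borel_measurable_sum borel_measurable_times measurable_at_labels) auto

section \<open>The expansion of the generating functional\<close>

text \<open>
  For nonnegative \<open>h\<close> this is the integral in the generating functional. Its values are extended
  nonnegative reals, so that Tonelli applies without any discussion of integrability.
\<close>
definition weight :: "'a measure \<Rightarrow> ('a list \<Rightarrow> real) \<Rightarrow> ('a \<Rightarrow> real) \<Rightarrow> nat set \<Rightarrow> ennreal" where
  "weight M p h S = (\<integral>\<^sup>+x. ennreal ((\<Prod>i\<in>S. h (x i)) * at_labels p x S) \<partial>PiM S (\<lambda>_. M))"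

definition pgfl_coeff :: "'a measure \<Rightarrow> ('a list \<Rightarrow> real) \<Rightarrow> ('a \<Rightarrow> real) \<Rightarrow> nat \<Rightarrow> real" where
  "pgfl_coeff M p h n = enn2real (weight M p h {..<n}) / fact n"

lemma measurable_prod_points:
  fixes h :: "'a \<Rightarrow> real"
  assumes "h \<in> borel_measurable M" "S \<subseteq> I"
  shows "(\<lambda>x. \<Prod>i\<in>S. h (x i)) \<in> borel_measurable (PiM I (\<lambda>_. M))"
proof (rule borel_measurable_prod)
  fix i assume "i \<in> S"
  then have "i \<in> I" using assms by auto
  from measurable_component_singleton[OF this, of "\<lambda>_. M"] assms(1)
  show "(\<lambda>x. h (x i)) \<in> borel_measurable (PiM I (\<lambda>_. M))"
    by (rule measurable_compose)
qed

context sigma_finite_measure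
begin

lemma weight_bij:
  assumes p: "janossy_densities M p" and hM: "h \<in> borel_measurable M"
    and e: "bij_betw e J I" and I: "finite I"
  shows "weight M p h I = weight M p h J"
proof -
  have J: "finite J" "e ` J = I" "inj_on e J" using e I bij_betw_finite[OF e] by (auto simp: bij_betw_def)
  have "weight M p h J
      = (\<integral>\<^sup>+x. ennreal ((\<Prod>j\<in>J. h (reindex J e x j)) * at_labels p (reindex J e x) J) \<partial>PiM I (\<lambda>_. M))"
    unfolding weight_def
    by (rule nn_integral_reindex[OF e I, symmetric])
      (intro measurable_compose[OF _ measurable_ennreal] borel_measurable_times
        measurable_prod_points measurable_at_labels p hM J order_refl)
  also have "\<dots> = weight M p h I"
    unfolding weight_def
  proof (rule nn_integral_cong)
    fix x assume x: "x \<in> space (PiM I (\<lambda>_. M))"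
    have "(\<Prod>j\<in>J. h (reindex J e x j)) = (\<Prod>j\<in>J. h (x (e j)))"
      by (intro prod.cong) (auto simp: reindex_def)
    also have "\<dots> = (\<Prod>i\<in>I. h (x i))" by (rule prod.reindex_bij_betw[OF e])
    finally show "ennreal ((\<Prod>j\<in>J. h (reindex J e x j)) * at_labels p (reindex J e x) J)
        = ennreal ((\<Prod>i\<in>I. h (x i)) * at_labels p x I)"
      using at_labels_reindex[OF p J(1) order_refl J(3)] x J(2) by (auto simp: space_PiM PiE_iff)
  qed
  finally show ?thesis ..
qed

lemma weight_card:
  assumes "janossy_densities M p" "h \<in> borel_measurable M" "finite S"
  shows "weight M p h S = weight M p h {..<card S}"
  using weight_bij[OF assms(1,2) bij_betw_enumerate assms(3)] assms(3) by simp

text \<open>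
  For fixed \<open>T\<close> the integrand is a function of the coordinates in \<open>T\<close> times a function of the
  remaining coordinates, so its integral factors.
\<close>
lemma weight_superposed:
  assumes q: "janossy_densities M q" and r: "janossy_densities M r"
    and hM: "h \<in> borel_measurable M" and h0: "\<And>x. 0 \<le> h x" and S: "finite S"
  shows "(\<integral>\<^sup>+x. ennreal ((\<Prod>i\<in>S. h (x i)) * superposed q r x S) \<partial>PiM S (\<lambda>_. M))
    = (\<Sum>T\<in>Pow S. weight M q h T * weight M r h (S - T))"
proof -
  let ?F = "\<lambda>s x T. ennreal ((\<Prod>i\<in>T. h (x i)) * at_labels s x T)"
  have FM: "(\<lambda>x. ?F s x T) \<in> borel_measurable (PiM I (\<lambda>_. M))"
    if "janossy_densities M s" "T \<subseteq> I" "finite T" for s T and I :: "nat set"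
    by (intro measurable_compose[OF _ measurable_ennreal] borel_measurable_times
        measurable_prod_points measurable_at_labels that hM)
  have "(\<integral>\<^sup>+x. ennreal ((\<Prod>i\<in>S. h (x i)) * superposed q r x S) \<partial>PiM S (\<lambda>_. M))
      = (\<integral>\<^sup>+x. (\<Sum>T\<in>Pow S. ?F q x T * ?F r x (S - T)) \<partial>PiM S (\<lambda>_. M))"
  proof (rule nn_integral_cong)
    fix x assume x: "x \<in> space (PiM S (\<lambda>_. M))"
    have *: "?F q x T * ?F r x (S - T)
        = ennreal ((\<Prod>i\<in>S. h (x i)) * (at_labels q x T * at_labels r x (S - T)))"
      and **: "0 \<le> (\<Prod>i\<in>S. h (x i)) * (at_labels q x T * at_labels r x (S - T))" if "T \<in> Pow S" for T
    proof -
      have T: "T \<subseteq> S" "finite T" using that S finite_subset by auto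
      have nn: "0 \<le> at_labels q x T" "0 \<le> at_labels r x (S - T)"
        using x T S by (auto intro!: at_labels_nonneg[OF q] at_labels_nonneg[OF r] simp: space_PiM PiE_iff)
      have pr: "(\<Prod>i\<in>S. h (x i)) = (\<Prod>i\<in>T. h (x i)) * (\<Prod>i\<in>S - T. h (x i))"
        using prod.subset_diff[OF T(1) S, of "\<lambda>i. h (x i)"] by (simp add: mult.commute)
      have "?F q x T * ?F r x (S - T)
        = ennreal (((\<Prod>i\<in>T. h (x i)) * at_labels q x T) * ((\<Prod>i\<in>S - T. h (x i)) * at_labels r x (S - T)))"
        using nn h0 by (intro ennreal_mult[symmetric] mult_nonneg_nonneg prod_nonneg) auto
      then show "?F q x T * ?F r x (S - T)
        = ennreal ((\<Prod>i\<in>S. h (x i)) * (at_labels q x T * at_labels r x (S - T)))"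
        unfolding pr by (simp only: mult_ac)
      show "0 \<le> (\<Prod>i\<in>S. h (x i)) * (at_labels q x T * at_labels r x (S - T))"
        using nn h0 by (intro mult_nonneg_nonneg prod_nonneg) auto
    qed
    have "(\<Sum>T\<in>Pow S. ?F q x T * ?F r x (S - T))
        = (\<Sum>T\<in>Pow S. ennreal ((\<Prod>i\<in>S. h (x i)) * (at_labels q x T * at_labels r x (S - T))))"
      by (intro sum.cong refl *)
    also have "\<dots> = ennreal (\<Sum>T\<in>Pow S. (\<Prod>i\<in>S. h (x i)) * (at_labels q x T * at_labels r x (S - T)))"
      by (rule sum_ennreal) (rule **)
    also have "\<dots> = ennreal ((\<Prod>i\<in>S. h (x i)) * superposed q r x S)"
      unfolding superposed_def sum_distrib_left ..
    finally show "ennreal ((\<Prod>i\<in>S. h (x i)) * superposed q r x S) = (\<Sum>T\<in>Pow S. ?F q x T * ?F r x (S - T))" ..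
  qed
  also have "\<dots> = (\<Sum>T\<in>Pow S. \<integral>\<^sup>+x. ?F q x T * ?F r x (S - T) \<partial>PiM S (\<lambda>_. M))"
  proof (rule nn_integral_sum)
    fix T assume "T \<in> Pow S"
    then have "T \<subseteq> S" "finite T" using S finite_subset by auto
    then show "(\<lambda>x. ?F q x T * ?F r x (S - T)) \<in> borel_measurable (PiM S (\<lambda>_. M))"
      using S by (intro borel_measurable_times_ennreal FM q r) auto
  qed
  also have "\<dots> = (\<Sum>T\<in>Pow S. weight M q h T * weight M r h (S - T))"
  proof (rule sum.cong[OF refl])
    fix T assume "T \<in> Pow S"
    then have T: "T \<subseteq> S" "finite T" "finite (S - T)" "T \<union> (S - T) = S" using S finite_subset by auto
    have 1: "?F q (merge T (S - T) (x, y)) T = ?F q x T" for x y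
    proof -
      have "map (merge T (S - T) (x, y)) (sorted_list_of_set T) = map x (sorted_list_of_set T)"
        using T by (auto simp: merge_def)
      moreover have "(\<Prod>i\<in>T. h (merge T (S - T) (x, y) i)) = (\<Prod>i\<in>T. h (x i))"
        by (intro prod.cong) (auto simp: merge_def)
      ultimately show ?thesis by (simp only: at_labels_def)
    qed
    have 2: "?F r (merge T (S - T) (x, y)) (S - T) = ?F r y (S - T)" for x y
    proof -
      have "map (merge T (S - T) (x, y)) (sorted_list_of_set (S - T)) = map y (sorted_list_of_set (S - T))"
        using T by (auto simp: merge_def)
      moreover have "(\<Prod>i\<in>S - T. h (merge T (S - T) (x, y) i)) = (\<Prod>i\<in>S - T. h (y i))"
        by (intro prod.cong) (auto simp: merge_def)
      ultimately show ?thesis by (simp only: at_labels_def)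
    qed
    have "(\<integral>\<^sup>+x. ?F q x T * ?F r x (S - T) \<partial>PiM S (\<lambda>_. M))
        = (\<integral>\<^sup>+x. ?F q x T * ?F r x (S - T) \<partial>PiM (T \<union> (S - T)) (\<lambda>_. M))"
      by (simp only: T)
    also have "\<dots> = (\<integral>\<^sup>+x. \<integral>\<^sup>+y. ?F q (merge T (S - T) (x, y)) T * ?F r (merge T (S - T) (x, y)) (S - T)
           \<partial>PiM (S - T) (\<lambda>_. M) \<partial>PiM T (\<lambda>_. M))"
      by (rule product.product_nn_integral_fold)
        (use T in \<open>auto intro!: borel_measurable_times_ennreal FM q r\<close>)
    also have "\<dots> = (\<integral>\<^sup>+x. \<integral>\<^sup>+y. ?F q x T * ?F r y (S - T) \<partial>PiM (S - T) (\<lambda>_. M) \<partial>PiM T (\<lambda>_. M))"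
      by (simp only: 1 2)
    also have "\<dots> = (\<integral>\<^sup>+x. ?F q x T * weight M r h (S - T) \<partial>PiM T (\<lambda>_. M))"
      unfolding weight_def by (intro nn_integral_cong nn_integral_cmult FM r T order_refl)
    also have "\<dots> = weight M q h T * weight M r h (S - T)"
      unfolding weight_def[of M q] by (intro nn_integral_multc FM q T order_refl)
    finally show "(\<integral>\<^sup>+x. ?F q x T * ?F r x (S - T) \<partial>PiM S (\<lambda>_. M)) = weight M q h T * weight M r h (S - T)" .
  qed
  finally show ?thesis .
qed

text \<open>
  By symmetry a term depends on \<open>T\<close> only through its cardinality.
\<close>
lemma weight_superposed_lessThan:
  assumes q: "janossy_densities M q" and r: "janossy_densities M r"
    and hM: "h \<in> borel_measurable M" and h0: "\<And>x. 0 \<le> h x"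
  shows "(\<integral>\<^sup>+x. ennreal ((\<Prod>i<n. h (x i)) * superposed q r x {..<n}) \<partial>points_measure M n)
    = (\<Sum>k\<le>n. of_nat (n choose k) * (weight M q h {..<k} * weight M r h {..<n - k}))"
proof -
  let ?w = "\<lambda>k. weight M q h {..<k} * weight M r h {..<n - k}"
  have "(\<Sum>T\<in>Pow {..<n}. weight M q h T * weight M r h ({..<n} - T)) = (\<Sum>T\<in>Pow {..<n}. ?w (card T))"
  proof (rule sum.cong[OF refl])
    fix T assume "T \<in> Pow {..<n}"
    then have "finite T" "T \<subseteq> {..<n}" using finite_subset by auto
    then show "weight M q h T * weight M r h ({..<n} - T) = ?w (card T)"
      using weight_card[OF q hM, of T] weight_card[OF r hM, of "{..<n} - T"]
      by (simp add: card_Diff_subset)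
  qed
  also have "\<dots> = (\<Sum>k\<le>n. \<Sum>T | T \<in> Pow {..<n} \<and> card T = k. ?w (card T))"
    by (rule sum.group[symmetric]) (auto dest: card_mono[rotated])
  also have "\<dots> = (\<Sum>k\<le>n. of_nat (n choose k) * ?w k)"
    using n_subsets[of "{..<n}"] by simp
  finally show ?thesis
    using weight_superposed[where h = h and S = "{..<n}", OF q r hM h0] by simp
qed

lemma weight_le_one:
  assumes p: "janossy_densities M p" and h01: "\<And>x. 0 \<le> h x \<and> h x \<le> 1" and "finite S"
  shows "weight M p h S \<le> weight M p (\<lambda>_. 1) S"
  unfolding weight_def
proof (rule nn_integral_mono)
  fix x assume x: "x \<in> space (PiM S (\<lambda>_. M))"
  have "0 \<le> at_labels p x S" using x assms by (intro at_labels_nonneg[OF p]) (auto simp: space_PiM)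
  moreover have "(\<Prod>i\<in>S. h (x i)) \<le> 1" using h01 by (intro prod_le_1) auto
  ultimately show "ennreal ((\<Prod>i\<in>S. h (x i)) * at_labels p x S) \<le> ennreal ((\<Prod>i\<in>S. 1) * at_labels p x S)"
    by (intro ennreal_leI mult_right_mono) auto
qed

lemma weight_empty: "weight M p h {} = ennreal (p [])"
  unfolding weight_def by (subst product.nn_integral_empty) simp_all

lemma total_weight:
  assumes p: "janossy_densities M p"
  shows "(\<Sum>n. ennreal (1 / fact (Suc n)) * weight M p (\<lambda>_. 1) {..<Suc n}) \<le> 1"
proof -
  have "(\<Sum>n. ennreal (1 / fact (Suc n)) * weight M p (\<lambda>_. 1) {..<Suc n})
      \<le> ennreal (p []) + (\<Sum>n. ennreal (1 / fact (Suc n)) * weight M p (\<lambda>_. 1) {..<Suc n})"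
    by (rule add_increasing) simp_all
  also have "\<dots> = 1"
    using p unfolding janossy_densities_def weight_def at_labels_lessThan prod.neutral_const mult_1_left
    by blast
  finally show ?thesis .
qed

lemma weight_finite:
  assumes p: "janossy_densities M p" and h01: "\<And>x. 0 \<le> h x \<and> h x \<le> 1"
  shows "weight M p h {..<n} < \<infinity>"
proof (cases n)
  case 0
  then show ?thesis using weight_empty[of p h] by simp
next
  case (Suc m)
  let ?w = "weight M p (\<lambda>_. 1) {..<Suc m}"
  have "ennreal (1 / fact (Suc m)) * ?w < \<infinity>"
    by (rule ennreal_suminf_lessD[where f = "\<lambda>n. ennreal (1 / fact (Suc n)) * weight M p (\<lambda>_. 1) {..<Suc n}"])
      (rule le_less_trans[OF total_weight[OF p]], simp)
  moreover have "ennreal (1 / fact (Suc m)) * top = top"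
    by (simp add: ennreal_mult_eq_top_iff del: fact_Suc)
  ultimately have "?w \<noteq> top" by (metis infinity_ennreal_def less_irrefl)
  then have "?w < \<infinity>" by (simp only: infinity_ennreal_def less_top)
  with weight_le_one[where h = h and S = "{..<Suc m}", OF p h01 finite_lessThan] show ?thesis
    unfolding Suc by (rule le_less_trans)
qed

lemma pgfl_coeff_nonneg: "0 \<le> pgfl_coeff M p h n"
  by (simp add: pgfl_coeff_def)

lemma summable_pgfl_coeff:
  assumes p: "janossy_densities M p" and h01: "\<And>x. 0 \<le> h x \<and> h x \<le> 1"
  shows "summable (pgfl_coeff M p h)"
proof -
  have "ennreal (pgfl_coeff M p h (Suc n)) \<le> ennreal (1 / fact (Suc n)) * weight M p (\<lambda>_. 1) {..<Suc n}" for n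
  proof -
    have "ennreal (pgfl_coeff M p h (Suc n)) = ennreal (1 / fact (Suc n)) * ennreal (enn2real (weight M p h {..<Suc n}))"
      by (subst ennreal_mult[symmetric]) (simp_all add: pgfl_coeff_def del: fact_Suc)
    also have "ennreal (enn2real (weight M p h {..<Suc n})) = weight M p h {..<Suc n}"
      using weight_finite[where h = h, OF p h01, of "Suc n"] by simp
    finally have "ennreal (pgfl_coeff M p h (Suc n)) = ennreal (1 / fact (Suc n)) * weight M p h {..<Suc n}" .
    then show ?thesis using weight_le_one[where h = h and S = "{..<Suc n}", OF p h01]
      by (simp add: mult_left_mono)
  qed
  then have "(\<Sum>n. ennreal (pgfl_coeff M p h (Suc n)))
      \<le> (\<Sum>n. ennreal (1 / fact (Suc n)) * weight M p (\<lambda>_. 1) {..<Suc n})"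
    by (intro suminf_le summableI)
  also note total_weight[OF p]
  finally have le: "(\<Sum>n. ennreal (pgfl_coeff M p h (Suc n))) \<le> 1" .
  have "summable (\<lambda>n. pgfl_coeff M p h (Suc n))"
  proof (rule summable_suminf_not_top[OF pgfl_coeff_nonneg])
    show "(\<Sum>n. ennreal (pgfl_coeff M p h (Suc n))) \<noteq> top"
      using le_less_trans[OF le ennreal_one_less_top] by (rule less_imp_neq)
  qed
  then show ?thesis by (simp add: summable_Suc_iff)
qed

lemma summable_power_pgfl_coeff:
  assumes "janossy_densities M p" "\<And>x. 0 \<le> h x \<and> h x \<le> 1" "\<bar>t\<bar> \<le> 1"
  shows "summable (\<lambda>n. norm (t ^ n * pgfl_coeff M p h n))"
proof (rule summable_comparison_test'[OF summable_pgfl_coeff[where h = h, OF assms(1,2)]])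
  show "norm (norm (t ^ n * pgfl_coeff M p h n)) \<le> pgfl_coeff M p h n" for n
    using mult_right_mono[OF power_le_one[of "\<bar>t\<bar>" n] pgfl_coeff_nonneg[of p h n]] assms(3) pgfl_coeff_nonneg[of p h n]
    by (simp add: abs_mult power_abs)
qed

text \<open>
  Here \<open>t\<close> may be negative: comparing coefficients uses a two-sided neighbourhood of 0. The
  absolute convergence for \<open>\<bar>t\<bar> \<le> 1\<close> comes from the total mass.
\<close>
lemma pgfl_power_series:
  assumes p: "janossy_densities M p" and hM: "h \<in> borel_measurable M"
    and h01: "\<And>x. 0 \<le> h x \<and> h x \<le> 1" and t: "\<bar>t\<bar> \<le> 1"
  shows "(\<lambda>n. t ^ n * pgfl_coeff M p h n) sums pgfl M p (\<lambda>x. t * h x)"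
proof -
  have term_eq: "1 / fact n * (\<integral>x. (\<Prod>i<n. t * h (x i)) * p (map x [0..<n]) \<partial>points_measure M n)
      = t ^ n * pgfl_coeff M p h n" for n
  proof -
    have "(\<integral>x. (\<Prod>i<n. t * h (x i)) * p (map x [0..<n]) \<partial>points_measure M n)
        = (\<integral>x. t ^ n * ((\<Prod>i<n. h (x i)) * at_labels p x {..<n}) \<partial>points_measure M n)"
      by (simp add: prod.distrib at_labels_lessThan mult.assoc)
    also have "\<dots> = t ^ n * (\<integral>x. (\<Prod>i<n. h (x i)) * at_labels p x {..<n} \<partial>points_measure M n)"
      by (rule integral_mult_right_zero)
    also have "(\<integral>x. (\<Prod>i<n. h (x i)) * at_labels p x {..<n} \<partial>points_measure M n) = enn2real (weight M p h {..<n})"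
      unfolding weight_def
    proof (rule integral_eq_nn_integral)
      show "(\<lambda>x. (\<Prod>i<n. h (x i)) * at_labels p x {..<n}) \<in> borel_measurable (points_measure M n)"
        by (intro borel_measurable_times measurable_prod_points measurable_at_labels p hM) auto
      show "AE x in points_measure M n. 0 \<le> (\<Prod>i<n. h (x i)) * at_labels p x {..<n}"
      proof (rule AE_I2)
        fix x assume "x \<in> space (points_measure M n)"
        then have "0 \<le> at_labels p x {..<n}"
          by (intro at_labels_nonneg[OF p]) (auto simp: space_PiM PiE_iff)
        moreover have "0 \<le> (\<Prod>i<n. h (x i))" using h01 by (simp add: prod_nonneg)
        ultimately show "0 \<le> (\<Prod>i<n. h (x i)) * at_labels p x {..<n}" by simp
      qed
    qed
    finally show ?thesis by (simp add: pgfl_coeff_def)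
  qed
  have "pgfl M p (\<lambda>x. t * h x) = p [] + (\<Sum>n. t ^ Suc n * pgfl_coeff M p h (Suc n))"
    unfolding pgfl_def by (simp only: term_eq)
  moreover have "p [] = t ^ 0 * pgfl_coeff M p h 0"
    using janossy_densities_nonneg[OF p, of "[]"] by (simp add: pgfl_coeff_def weight_empty)
  moreover have "summable (\<lambda>n. t ^ n * pgfl_coeff M p h n)"
    using summable_power_pgfl_coeff[where h = h, OF p h01 t] by (rule summable_norm_cancel)
  ultimately have "pgfl M p (\<lambda>x. t * h x) = (\<Sum>n. t ^ n * pgfl_coeff M p h n)"
    using suminf_split_head[of "\<lambda>n. t ^ n * pgfl_coeff M p h n"] by linarith
  then show ?thesis
    using summable_sums[OF \<open>summable (\<lambda>n. t ^ n * pgfl_coeff M p h n)\<close>] by simp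
qed

section \<open>The density of a superposition\<close>

text \<open>
  Both sides of \<open>G[t h] = G\<^sub>1[t h] G\<^sub>2[t h]\<close> are power series in \<open>t\<close>, the right one being a Cauchy product.
\<close>
lemma pgfl_coeff_superposition:
  assumes p: "point_process M G p" and q: "point_process M G1 q" and r: "point_process M G2 r"
    and sup: "superposition M G G1 G2"
    and hM: "h \<in> borel_measurable M" and h01: "\<And>x. 0 \<le> h x \<and> h x \<le> 1"
  shows "pgfl_coeff M p h n = (\<Sum>k\<le>n. pgfl_coeff M q h k * pgfl_coeff M r h (n - k))"
proof -
  have J: "janossy_densities M p" "janossy_densities M q" "janossy_densities M r"
    using p q r by (auto simp: point_process_def)
  have "pgfl_coeff M p h n - (\<Sum>k\<le>n. pgfl_coeff M q h k * pgfl_coeff M r h (n - k)) = 0"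
  proof (rule power_series_zero[where a = "\<lambda>n. pgfl_coeff M p h n - (\<Sum>k\<le>n. pgfl_coeff M q h k * pgfl_coeff M r h (n - k))"])
    fix t :: real assume "\<bar>t\<bar> < 1"
    then have t: "\<bar>t\<bar> \<le> 1" by simp
    have "test_function M (\<lambda>x. t * h x)"
      using t h01 hM by (auto simp: test_function_def abs_mult intro!: mult_le_one)
    then have prod: "pgfl M p (\<lambda>x. t * h x) = pgfl M q (\<lambda>x. t * h x) * pgfl M r (\<lambda>x. t * h x)"
      using p q r sup by (simp add: point_process_def superposition_def)
    note series = pgfl_power_series[where h = h, OF _ hM h01 t]
    have "(\<lambda>n. \<Sum>k\<le>n. t ^ k * pgfl_coeff M q h k * (t ^ (n - k) * pgfl_coeff M r h (n - k)))
        sums (pgfl M q (\<lambda>x. t * h x) * pgfl M r (\<lambda>x. t * h x))"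
      using Cauchy_product_sums[OF summable_power_pgfl_coeff[where h = h, OF J(2) h01 t] summable_power_pgfl_coeff[where h = h, OF J(3) h01 t]]
        series[OF J(2)] series[OF J(3)] by (simp add: sums_iff)
    also have "(\<lambda>n. \<Sum>k\<le>n. t ^ k * pgfl_coeff M q h k * (t ^ (n - k) * pgfl_coeff M r h (n - k)))
        = (\<lambda>n. t ^ n * (\<Sum>k\<le>n. pgfl_coeff M q h k * pgfl_coeff M r h (n - k)))"
    proof (rule ext, subst sum_distrib_left, rule sum.cong[OF refl])
      fix n k :: nat assume "k \<in> {..n}"
      then have "t ^ n = t ^ k * t ^ (n - k)" by (simp flip: power_add)
      then show "t ^ k * pgfl_coeff M q h k * (t ^ (n - k) * pgfl_coeff M r h (n - k)) = t ^ n * (pgfl_coeff M q h k * pgfl_coeff M r h (n - k))"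
        by simp
    qed
    finally have "(\<lambda>n. t ^ n * pgfl_coeff M p h n - t ^ n * (\<Sum>k\<le>n. pgfl_coeff M q h k * pgfl_coeff M r h (n - k))) sums
        (pgfl M p (\<lambda>x. t * h x) - pgfl M q (\<lambda>x. t * h x) * pgfl M r (\<lambda>x. t * h x))"
      by (rule sums_diff[OF series[OF J(1)]])
    then show "(\<lambda>n. (pgfl_coeff M p h n - (\<Sum>k\<le>n. pgfl_coeff M q h k * pgfl_coeff M r h (n - k))) * t ^ n) sums 0"
      by (simp add: prod left_diff_distrib right_diff_distrib mult.commute)
  qed
  then show ?thesis by simp
qed

lemma weight_superposition:
  assumes p: "point_process M G p" and q: "point_process M G1 q" and r: "point_process M G2 r"
    and sup: "superposition M G G1 G2"
    and hM: "h \<in> borel_measurable M" and h01: "\<And>x. 0 \<le> h x \<and> h x \<le> 1"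
  shows "weight M p h {..<n}
    = (\<Sum>k\<le>n. of_nat (n choose k) * (weight M q h {..<k} * weight M r h {..<n - k}))"
proof -
  have J: "janossy_densities M p" "janossy_densities M q" "janossy_densities M r"
    using p q r by (auto simp: point_process_def)
  have W: "weight M s h {..<k} = ennreal (fact k * pgfl_coeff M s h k)" if "janossy_densities M s" for s k
    using weight_finite[where h = h, OF that h01, of k] by (simp add: pgfl_coeff_def)
  have "fact n * pgfl_coeff M p h n = (\<Sum>k\<le>n. real (n choose k) * (fact k * pgfl_coeff M q h k * (fact (n - k) * pgfl_coeff M r h (n - k))))"
    unfolding pgfl_coeff_superposition[OF assms] sum_distrib_left
  proof (rule sum.cong[OF refl])
    fix k assume "k \<in> {..n}"
    then have "fact n = real (n choose k) * fact k * fact (n - k)"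
      by (simp add: binomial_fact)
    then show "fact n * (pgfl_coeff M q h k * pgfl_coeff M r h (n - k))
        = real (n choose k) * (fact k * pgfl_coeff M q h k * (fact (n - k) * pgfl_coeff M r h (n - k)))"
      by simp
  qed
  then show ?thesis
    by (simp add: W[OF J(1)] W[OF J(2)] W[OF J(3)] ennreal_mult[symmetric] pgfl_coeff_nonneg
        ennreal_of_nat_eq_real_of_nat)
qed

lemma AE_superposed_lessThan:
  assumes p: "point_process M G p" and q: "point_process M G1 q" and r: "point_process M G2 r"
    and sup: "superposition M G G1 G2"
  shows "AE x in points_measure M n. at_labels p x {..<n} = superposed q r x {..<n}"
proof (rule symmetric_AE_eqI)
  have J: "janossy_densities M p" "janossy_densities M q" "janossy_densities M r"
    using p q r by (auto simp: point_process_def)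
  let ?P = "points_measure M n"
  show "(\<lambda>x. at_labels p x {..<n}) \<in> borel_measurable ?P" "(\<lambda>x. superposed q r x {..<n}) \<in> borel_measurable ?P"
    using J by (auto intro!: measurable_at_labels measurable_superposed)
  fix x assume x: "x \<in> space ?P"
  then show "0 \<le> at_labels p x {..<n}" "0 \<le> superposed q r x {..<n}"
    using J by (auto intro!: at_labels_nonneg superposed_nonneg simp: space_PiM PiE_iff)
  fix e assume e: "bij_betw e {..<n} {..<n}"
  then have eI: "e ` {..<n} = {..<n}" "inj_on e {..<n}" by (auto simp: bij_betw_def)
  have xe: "x (e i) \<in> space M" if "i \<in> {..<n}" for i
    using x that eI(1) by (auto simp: space_PiM PiE_iff)
  show "at_labels p (reindex {..<n} e x) {..<n} = at_labels p x {..<n}"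
    using at_labels_reindex[where x = x and e = e, OF J(1) _ order_refl eI(2) xe] eI(1) by simp
  show "superposed q r (reindex {..<n} e x) {..<n} = superposed q r x {..<n}"
    using superposed_reindex[where x = x and e = e, OF J(2,3) _ order_refl eI(2) xe] eI(1) by simp
next
  have J: "janossy_densities M p" "janossy_densities M q" "janossy_densities M r"
    using p q r by (auto simp: point_process_def)
  show "(\<integral>\<^sup>+x. ennreal (at_labels p x {..<n}) \<partial>points_measure M n) < \<infinity>"
    using weight_finite[where h = "\<lambda>_. 1", OF J(1), of n] by (simp add: weight_def)
  fix h :: "'a \<Rightarrow> real" assume hM: "h \<in> borel_measurable M" and h01: "\<And>x. 0 \<le> h x \<and> h x \<le> 1"
  show "(\<integral>\<^sup>+x. ennreal ((\<Prod>i<n. h (x i)) * at_labels p x {..<n}) \<partial>points_measure M n)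
    = (\<integral>\<^sup>+x. ennreal ((\<Prod>i<n. h (x i)) * superposed q r x {..<n}) \<partial>points_measure M n)"
    using weight_superposition[where h = h and n = n, OF assms hM h01]
      weight_superposed_lessThan[where h = h and n = n, OF J(2,3) hM] h01
    by (simp add: weight_def)
qed simp

text \<open>
  On a larger index set \<open>I\<close>, the exceptional points for the labels \<open>S\<close> form the preimage of a null set of
  \<open>card S\<close>-tuples under the selection of the coordinates in \<open>S\<close>.
\<close>
lemma AE_superposed:
  assumes p: "point_process M G p" and q: "point_process M G1 q" and r: "point_process M G2 r"
    and sup: "superposition M G G1 G2" and I: "finite I" "S \<subseteq> I"
  shows "AE x in PiM I (\<lambda>_. M). at_labels p x S = superposed q r x S"
proof -
  have J: "janossy_densities M q" "janossy_densities M r"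
    using q r by (auto simp: point_process_def)
  have S: "finite S" using I finite_subset by auto
  let ?e = "(!) (sorted_list_of_set S)"
  have e: "inj_on ?e {..<card S}" "?e ` {..<card S} = S"
    using bij_betw_enumerate[OF S] by (auto simp: bij_betw_def)
  have "AE x in PiM I (\<lambda>_. M). at_labels p (reindex {..<card S} ?e x) {..<card S}
      = superposed q r (reindex {..<card S} ?e x) {..<card S}"
    using e I by (intro AE_reindex AE_superposed_lessThan[OF p q r sup]) auto
  with AE_space show ?thesis
  proof eventually_elim
    case (elim x)
    have "x (?e i) \<in> space M" if "i \<in> {..<card S}" for i
      using elim(1) that e(2) I by (auto simp: space_PiM PiE_iff)
    from superposed_reindex[where x = x and e = ?e, OF J _ order_refl e(1) this] elim(2) e(2) show ?case
      by (simp add: at_labels_enumerate[OF S, of p])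
  qed
qed

end

section \<open>The densities of the second process\<close>

theorem mainTheorem3:
  fixes M :: "'a measure"
    and G G1 G2 :: "('a \<Rightarrow> real) \<Rightarrow> real"
    and p q r :: "'a list \<Rightarrow> real"
  assumes "sigma_finite_measure M"
    and "point_process M G p"
    and "point_process M G1 q"
    and "point_process M G2 r"
    and "superposition M G G1 G2"
    and "q [] \<noteq> 0"
  shows "r [] = p [] / q [] \<and>
    (\<forall>n>0. AE x in points_measure M n.
       r (map x [0..<n]) =
         (\<Sum>S\<in>Pow {..<n}.
            (\<Sum>\<pi> | partition_on S \<pi>.
               (- 1) ^ card \<pi> * fact (card \<pi>) / q [] ^ (card \<pi> + 1) *
               (\<Prod>\<omega>\<in>\<pi>. at_labels q x \<omega>)) *
            at_labels p x ({..<n} - S)))"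
proof (intro conjI allI impI)
  interpret sigma_finite_measure M by fact
  note process = assms(2-5)
  have "0 \<le> p []" "0 \<le> q []" "0 \<le> r []"
    using process(1-3) by (auto simp: point_process_def intro: janossy_densities_nonneg)
  then have "p [] = q [] * r []"
    using pgfl_coeff_superposition[where h = "\<lambda>_. 1" and n = 0, OF process] by (simp add: pgfl_coeff_def weight_empty)
  then show "r [] = p [] / q []" using assms(6) by simp
  fix n :: nat
  have "AE x in points_measure M n. \<forall>S\<in>Pow {..<n}. at_labels p x S = superposed q r x S"
    by (rule AE_finite_allI) (auto intro: AE_superposed[OF process])
  then show "AE x in points_measure M n.
       r (map x [0..<n]) =
         (\<Sum>S\<in>Pow {..<n}.
            (\<Sum>\<pi> | partition_on S \<pi>.
               (- 1) ^ card \<pi> * fact (card \<pi>) / q [] ^ (card \<pi> + 1) *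
               (\<Prod>\<omega>\<in>\<pi>. at_labels q x \<omega>)) *
            at_labels p x ({..<n} - S))"
  proof eventually_elim
    case (elim x)
    then show ?case
      using subset_convolution_inversion[of "{..<n}" "at_labels q x" "at_labels p x" "at_labels r x"] assms(6)
      by (simp add: superposed_def partition_coeff_def at_labels_lessThan)
  qed
qed

end
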